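(* Let $d \le 4$ be a positive integer. Then $\operatorname{rc}(X) \ge d+1$ holds for every $d$-dimensional finite lattice-convex set $X \subseteq \mathbb{Z}^d$.
   Context: A set $X \subseteq \mathbb{Z}^d$ is lattice-convex if $\operatorname{conv}(X) \cap \mathbb{Z}^d = X$; it is $d$-dimensional if its affine hull is $\mathbb{R}^d$. We say $X$ is described by $k$ linear inequalities within $\mathbb{Z}^d$ if $X = \{x \in \mathbb{Z}^d : Ax \le b,\ Ux = v\}$ for some real matrices $A, U$ and real vectors $b, v$, where $Ax \le b$ consists of $k$ inequalities (the number of equations $Ux=v$ is arbitrary and not counted). The relaxation complexity $\operatorname{rc}(X)$ is the minimal $k$ such that $X$ can be described by $k$ linear inequalities within $\mathbb{Z}^d$. *)

theory Defs
  imports "HOL-Analysis.Analysis" "HOL-Library.Extended_Nat"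
begin

definition int_lattice :: "(real ^ 'd) set" where
  "int_lattice = {x. \<forall>i. x $ i \<in> \<int>}"

definition lattice_convex :: "(real ^ 'd) set \<Rightarrow> bool" where
  "lattice_convex X \<longleftrightarrow> convex hull X \<inter> int_lattice = X"

text \<open>
  The matrices \<open>A\<close> and \<open>U\<close> are given by their rows \<open>A i\<close> for \<open>i < k\<close> and \<open>U j\<close> for \<open>j < m\<close>,
  since the numbers of rows \<open>k\<close> and \<open>m\<close> vary. Only the inequalities are counted by \<open>k\<close>;
  the number \<open>m\<close> of equations is arbitrary (possibly zero).
\<close>

definition described_by :: "(real ^ 'd) set \<Rightarrow> nat \<Rightarrow> bool" where
  "described_by X k \<longleftrightarrow>
    (\<exists>(A :: nat \<Rightarrow> real ^ 'd) (b :: nat \<Rightarrow> real) (m :: nat) (U :: nat \<Rightarrow> real ^ 'd) (v :: nat \<Rightarrow> real).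
      X = {x \<in> int_lattice. (\<forall>i<k. A i \<bullet> x \<le> b i) \<and> (\<forall>j<m. U j \<bullet> x = v j)})"

text \<open>
  Extended natural numbers are used so that the value is \<open>\<infinity>\<close>, the infimum of the empty set,
  when no finite description exists; otherwise the infimum is attained and is the minimal \<open>k\<close>.
\<close>

definition rc :: "(real ^ 'd) set \<Rightarrow> enat" where
  "rc X = (INF k \<in> {k. described_by X k}. enat k)"

end

theory Submission
  imports Defs
begin

text \<open>
  Equations vanish on the affine hull, so suppose that a full-dimensional finite \<open>X\<close> is the set of
  lattice points of \<open>P = {x. \<forall>i. a i \<bullet> x \<le> b i}\<close> with at most \<open>d\<close> inequalities. If the normals are a
  basis, then \<open>P\<close> contains arbitrarily large balls; otherwise \<open>P\<close> is invariant under a line \<open>\<real> l\<close>.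
  Let \<open>W\<close> be the smallest rational subspace containing \<open>l\<close>, and \<open>e \<ge> 2\<close> its dimension. By Kronecker's
  theorem the lattice points of \<open>W\<close> are dense in \<open>W\<close> modulo \<open>l\<close>. Hence in every lattice translate of
  \<open>W\<close> that meets \<open>P\<close> some inequality that is not constant on \<open>W\<close> is tight on all of \<open>P\<close>, since
  otherwise \<open>X\<close> would be infinite; by minimality of \<open>W\<close> the points of \<open>X\<close> in one translate span
  dimension at most \<open>e - 2\<close>.

  This excludes \<open>e = d\<close>. If \<open>e = d - 1\<close>, then \<open>X\<close> meets at most two translates, because the tight
  inequality of a translate in between would be tight on all of \<open>X\<close>; so \<open>X\<close> spans dimension at most
  \<open>2 (d - 3) + 1 < d\<close>. There remains \<open>d = 4\<close>, \<open>e = 2\<close>. The image of \<open>P\<close> in the plane modulo \<open>W\<close> has no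
  interior lattice points, and points of \<open>X\<close> over one of its edges are collinear, so five affinely
  independent points of \<open>X\<close> give five lattice points on its boundary with no three on an edge. Two of
  them agree modulo 2, their midpoint lies on the same edge, and replacing one of the two by the midpoint
  yields a smaller configuration of the same kind: an infinite descent.
\<close>

subsection \<open>Rational subspaces and density\<close>

lemma int_lattice_0: "0 \<in> int_lattice"
  by (simp add: int_lattice_def)

lemma int_lattice_add: "x \<in> int_lattice \<Longrightarrow> y \<in> int_lattice \<Longrightarrow> x + y \<in> int_lattice"
  by (simp add: int_lattice_def)

lemma int_lattice_diff: "x \<in> int_lattice \<Longrightarrow> y \<in> int_lattice \<Longrightarrow> x - y \<in> int_lattice"
  by (simp add: int_lattice_def)

lemma int_lattice_scaleR: "x \<in> int_lattice \<Longrightarrow> c \<in> \<int> \<Longrightarrow> c *\<^sub>R x \<in> int_lattice"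
  by (simp add: int_lattice_def)

lemma int_lattice_sum: "(\<And>i. i \<in> I \<Longrightarrow> f i \<in> int_lattice) \<Longrightarrow> sum f I \<in> int_lattice"
  by (induction I rule: infinite_finite_induct) (auto simp: int_lattice_0 int_lattice_add)

lemma Basis_subset_int_lattice: "(Basis :: (real ^ 'd) set) \<subseteq> int_lattice"
  by (auto simp: int_lattice_def Basis_vec_def axis_def)

text \<open>The vectors \<open>c j *\<^sub>R e i - c i *\<^sub>R e j\<close> with \<open>i\<close>
  different from \<open>j\<close> suffice: weighted by \<open>\<theta> i\<close> they add up to
  \<open>c j\<close> times the given sum, since the relation cancels the part along
  \<open>e j\<close>.\<close>

lemma integer_relation_reduces_span:
  fixes e :: "nat \<Rightarrow> real ^ 'd"
  assumes e: "\<And>i. i < n \<Longrightarrow> e i \<in> int_lattice"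
    and c: "\<And>i. i < n \<Longrightarrow> c i \<in> \<int>" "(\<Sum>i<n. c i * \<theta> i) = 0"
    and j: "j < n" "c j \<noteq> 0"
  obtains S where "S \<subseteq> int_lattice" "card S < n" "finite S" "(\<Sum>i<n. \<theta> i *\<^sub>R e i) \<in> span S"
proof
  let ?f = "\<lambda>i. c j *\<^sub>R e i - c i *\<^sub>R e j"
  let ?S = "?f ` ({..<n} - {j})"
  show "?S \<subseteq> int_lattice"
    using assms by (auto intro!: int_lattice_diff int_lattice_scaleR)
  show "finite ?S" by simp
  have "card ?S \<le> card ({..<n} - {j})"
    by (rule card_image_le) simp
  then show "card ?S < n" using j by simp
  have "(\<Sum>i\<in>{..<n}-{j}. \<theta> i *\<^sub>R ?f i) = (\<Sum>i<n. \<theta> i *\<^sub>R ?f i)"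
    using j by (subst (2) sum.remove[of _ j]) auto
  also have "\<dots> = c j *\<^sub>R (\<Sum>i<n. \<theta> i *\<^sub>R e i) - (\<Sum>i<n. c i * \<theta> i) *\<^sub>R e j"
    by (simp add: scaleR_diff_right sum_subtractf scaleR_sum_right scaleR_sum_left mult.commute)
  finally have "(\<Sum>i<n. \<theta> i *\<^sub>R e i) = (1 / c j) *\<^sub>R (\<Sum>i\<in>{..<n}-{j}. \<theta> i *\<^sub>R ?f i)"
    using c j by simp
  also have "\<dots> \<in> span ?S"
    by (intro span_scale span_sum) (auto intro: span_base)
  finally show "(\<Sum>i<n. \<theta> i *\<^sub>R e i) \<in> span ?S" .
qed

lemma span_bij_coordinates:
  fixes e :: "nat \<Rightarrow> 'a::real_vector"
  assumes "bij_betw e {..<n} B" "x \<in> span B"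
  obtains \<theta> where "x = (\<Sum>i<n. \<theta> i *\<^sub>R e i)"
proof -
  have fin: "finite B" using assms(1) bij_betw_finite by blast
  obtain u where "x = (\<Sum>v\<in>B. u v *\<^sub>R v)"
    using assms(2) span_finite[OF fin] by auto
  also have "\<dots> = (\<Sum>i<n. u (e i) *\<^sub>R e i)"
    using sum.reindex_bij_betw[OF assms(1), of "\<lambda>v. u v *\<^sub>R v"] by simp
  finally show ?thesis by (rule that)
qed

text \<open>Minimality of the rational subspace spanned by \<open>B\<close> makes the coordinates of \<open>l\<close>
  independent over the integers, so Kronecker's theorem applies.\<close>

lemma lattice_plus_line_dense:
  fixes B :: "(real ^ 'd) set"
  assumes B: "B \<subseteq> int_lattice" "independent B" and l: "l \<in> span B"
    and min: "\<And>S. S \<subseteq> int_lattice \<Longrightarrow> l \<in> span S \<Longrightarrow> card B \<le> dim S"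
    and y: "y \<in> span B" and "\<epsilon> > 0"
  obtains z t where "z \<in> int_lattice" "z \<in> span B" "norm (z + t *\<^sub>R l - y) < \<epsilon>"
proof -
  define n where "n = card B"
  have finB: "finite B" using B by (simp add: independent_imp_finite)
  obtain e where e: "bij_betw e {..<n} B"
    using ex_bij_betw_nat_finite[OF finB] by (auto simp: n_def atLeast0LessThan)
  have eB: "e i \<in> B" if "i < n" for i
    using e that bij_betwE by blast
  obtain \<theta> where \<theta>: "l = (\<Sum>i<n. \<theta> i *\<^sub>R e i)"
    using span_bij_coordinates[OF e l] by blast
  obtain \<beta> where \<beta>: "y = (\<Sum>i<n. \<beta> i *\<^sub>R e i)"
    using span_bij_coordinates[OF e y] by blast
  have no_rel: "c j = 0" if c: "\<And>i. i < n \<Longrightarrow> c i \<in> \<int>" "(\<Sum>i<n. c i * \<theta> i) = 0" "j < n" for c j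
  proof (rule ccontr)
    assume "c j \<noteq> 0"
    have eZ: "\<And>i. i < n \<Longrightarrow> e i \<in> int_lattice" using eB B by auto
    obtain S where S: "S \<subseteq> int_lattice" "card S < n" "finite S" "l \<in> span S"
      by (rule integer_relation_reduces_span[OF eZ c \<open>c j \<noteq> 0\<close>]) (simp_all add: \<theta>)
    have "dim S \<le> card S" using S by (simp add: dim_le_card')
    then show False using min[of S] S by (simp add: n_def)
  qed
  have inj: "inj_on \<theta> {..<n}"
  proof (rule inj_onI, rule ccontr)
    fix i j assume ij: "i \<in> {..<n}" "j \<in> {..<n}" "\<theta> i = \<theta> j" "i \<noteq> j"
    let ?c = "\<lambda>k. if k = i then 1 else if k = j then -1 else (0::real)"
    have "(\<Sum>k<n. ?c k * \<theta> k) = (\<Sum>k<n. (if k = i then \<theta> i else 0) - (if k = j then \<theta> j else 0))"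
      using ij by (intro sum.cong) auto
    also have "\<dots> = 0"
      using ij by (simp add: sum_subtractf)
    finally have "?c i = 0"
      using ij by (intro no_rel[of ?c i]) auto
    then show False by simp
  qed
  \<comment> \<open>Kronecker's theorem asks for independence in the reals as a module over the
    integers, which \<open>no_rel\<close> supplies.\<close>
  interpret Z: Modules.module "(\<lambda>r. (*) (real_of_int r))"
    by (simp add: Modules.module.intro distrib_left mult.commute)
  have indep: "Z.independent (\<theta> ` {..<n})"
  proof
    assume "Z.dependent (\<theta> ` {..<n})"
    then obtain u v where uv: "v \<in> \<theta> ` {..<n}" "u v \<noteq> 0" "(\<Sum>v\<in>\<theta> ` {..<n}. real_of_int (u v) * v) = 0"
      by (auto simp: Z.dependent_finite)
    then obtain j where j: "j < n" "v = \<theta> j" by auto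
    have "(\<Sum>i<n. real_of_int (u (\<theta> i)) * \<theta> i) = 0"
      using uv(3) by (simp add: sum.reindex[OF inj])
    then have "real_of_int (u (\<theta> j)) = 0"
      using no_rel[of "\<lambda>i. real_of_int (u (\<theta> i))" j] j by simp
    then show False using uv j by simp
  qed
  define s where "s = (\<Sum>i<n. norm (e i))"
  have s0: "s \<ge> 0" by (simp add: s_def sum_nonneg)
  \<comment> \<open>The 1 in the denominator rules out division by zero and makes the final estimate
    strict.\<close>
  have "\<epsilon> / (1 + s) > 0" using s0 \<open>\<epsilon> > 0\<close> by simp
  then obtain t h where th: "\<And>i. i < n \<Longrightarrow> \<bar>t * \<theta> i - of_int (h i) - \<beta> i\<bar> < \<epsilon> / (1 + s)"
    using Kronecker_thm_1[OF indep inj] by metis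
  define z where "z = (\<Sum>i<n. (- real_of_int (h i)) *\<^sub>R e i)"
  show thesis
  proof (rule that)
    show "z \<in> int_lattice"
      unfolding z_def using eB B by (intro int_lattice_sum int_lattice_scaleR) auto
    show "z \<in> span B"
      unfolding z_def using eB by (intro span_sum span_scale) (auto intro: span_base)
    have "z + t *\<^sub>R l - y = (\<Sum>i<n. (t * \<theta> i - of_int (h i) - \<beta> i) *\<^sub>R e i)"
      by (simp add: z_def \<theta> \<beta> scaleR_diff_left sum_subtractf scaleR_sum_right sum_negf)
    also have "norm \<dots> \<le> (\<Sum>i<n. \<epsilon> / (1 + s) * norm (e i))"
    proof (rule sum_norm_le)
      fix i assume "i \<in> {..<n}"
      then show "norm ((t * \<theta> i - of_int (h i) - \<beta> i) *\<^sub>R e i) \<le> \<epsilon> / (1 + s) * norm (e i)"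
        using mult_right_mono[OF less_imp_le[OF th[of i]] norm_ge_zero[of "e i"]] by simp
    qed
    also have "\<dots> = \<epsilon> * (s / (1 + s))"
      by (simp add: s_def sum_divide_distrib sum_distrib_left)
    also have "\<dots> < \<epsilon> * 1"
      using s0 \<open>\<epsilon> > 0\<close> by (intro mult_strict_left_mono) auto
    also have "\<dots> = \<epsilon>" by simp
    finally show "norm (z + t *\<^sub>R l - y) < \<epsilon>" .
  qed
qed

text \<open>A basis of the orthogonal complement serves. In codimension one it gives a normal vector
  of \<open>W\<close>, in codimension two a quadratic form with zero set \<open>W\<close>.\<close>

lemma subspace_eq_orthogonal_to_finite:
  fixes W :: "'a::euclidean_space set"
  assumes "subspace W"
  obtains C where "finite C" "card C = DIM('a) - dim W" "W = {x. \<forall>c\<in>C. c \<bullet> x = 0}"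
proof -
  obtain C where C: "C \<subseteq> W\<^sup>\<bottom>" "independent C" "W\<^sup>\<bottom> \<subseteq> span C" "card C = dim (W\<^sup>\<bottom>)"
    using basis_exists by blast
  have sp: "span C = W\<^sup>\<bottom>"
    using C by (simp add: span_minimal subspace_orthogonal_comp subset_antisym)
  have "W = (W\<^sup>\<bottom>)\<^sup>\<bottom>"
    using assms by (simp add: orthogonal_comp_self)
  also have "\<dots> = {x. \<forall>c\<in>C. c \<bullet> x = 0}"
  proof (intro subset_antisym subsetI CollectI ballI)
    fix x c assume "x \<in> (W\<^sup>\<bottom>)\<^sup>\<bottom>" "c \<in> C"
    then show "c \<bullet> x = 0" using C by (auto simp: orthogonal_comp_def orthogonal_def)
  next
    fix x assume x: "x \<in> {x. \<forall>c\<in>C. c \<bullet> x = 0}"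
    have "orthogonal x y" if "y \<in> span C" for y
      by (rule orthogonal_to_span[OF that]) (use x in \<open>auto simp: orthogonal_def inner_commute\<close>)
    then show "x \<in> (W\<^sup>\<bottom>)\<^sup>\<bottom>"
      by (auto simp: sp orthogonal_comp_def orthogonal_commute)
  qed
  finally have W: "W = {x. \<forall>c\<in>C. c \<bullet> x = 0}" .
  have "W\<^sup>\<bottom> = {y \<in> UNIV. \<forall>x\<in>W. orthogonal x y}"
    by (simp add: orthogonal_comp_def)
  then have "dim (W\<^sup>\<bottom>) + dim W = DIM('a)"
    using dim_subspace_orthogonal_to_vectors[OF assms subspace_UNIV] by simp
  then show thesis
    using that[of C] C W by (simp add: independent_imp_finite)
qed

subsection \<open>Lattice translates of the rational subspace\<close>

text \<open>In the interpretation below, \<open>B\<close> is a basis, made of lattice vectors, of a rational subspace of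
  minimal dimension containing \<open>l\<close>.\<close>

locale flat_description =
  fixes a :: "'i::finite \<Rightarrow> real ^ 'd" and b :: "'i \<Rightarrow> real"
    and X :: "(real ^ 'd) set" and l :: "real ^ 'd" and B :: "(real ^ 'd) set"
  assumes X_eq: "X = {x \<in> int_lattice. \<forall>i. a i \<bullet> x \<le> b i}"
    and finite_X: "finite X"
    and affine_hull_X: "affine hull X = UNIV"
    and l_nonzero: "l \<noteq> 0"
    and a_l: "a i \<bullet> l = 0"
    and B_lattice: "B \<subseteq> int_lattice"
    and B_indep: "independent B"
    and l_span: "l \<in> span B"
    and B_minimal: "S \<subseteq> int_lattice \<Longrightarrow> l \<in> span S \<Longrightarrow> card B \<le> dim S"
begin

definition W :: "(real ^ 'd) set" where "W = span B"
definition P :: "(real ^ 'd) set" where "P = {x. \<forall>i. a i \<bullet> x \<le> b i}"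
text \<open>Inequalities outside \<open>J\<close> are constant on translates of \<open>W\<close>, so
  they hold on a whole translate once it meets \<open>P\<close>.\<close>

definition J :: "'i set" where "J = {i. \<exists>w\<in>W. a i \<bullet> w \<noteq> 0}"

lemma subspace_W: "subspace W"
  by (simp add: W_def)

lemma dim_W: "dim W = card B"
  by (simp add: W_def dim_eq_card_independent[OF B_indep])

lemma l_W: "l \<in> W"
  by (simp add: W_def l_span)

lemma X_P: "X = P \<inter> int_lattice"
  by (auto simp: X_eq P_def)

lemma convex_P: "convex P"
  unfolding convex_def P_def
proof clarsimp
  fix x y and u v :: real and i
  assume *: "\<forall>i. a i \<bullet> x \<le> b i" "\<forall>i. a i \<bullet> y \<le> b i" "0 \<le> u" "0 \<le> v" "u + v = 1"
  show "a i \<bullet> (u *\<^sub>R x + v *\<^sub>R y) \<le> b i"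
    using * convex_bound_le[of "a i \<bullet> x" "b i" "a i \<bullet> y" u v] by (simp add: inner_add_right)
qed

lemma X_nonempty: "X \<noteq> {}"
  using affine_hull_X by (metis UNIV_not_empty affine_hull_empty)

text \<open>If \<open>l\<close> were a multiple of one lattice vector, adding multiples of that
  vector would never leave \<open>X\<close>.\<close>

lemma card_B_ge_2: "card B \<ge> 2"
proof (rule ccontr)
  assume "\<not> card B \<ge> 2"
  moreover have "card B \<noteq> 0"
    using B_indep l_span l_nonzero by (auto simp: independent_imp_finite)
  ultimately have "card B = 1" by linarith
  then obtain v where v: "B = {v}" by (auto simp: card_1_singleton_iff)
  then obtain c where c: "l = c *\<^sub>R v"
    using l_span by (auto simp: span_singleton)
  then have cv: "c \<noteq> 0" "v \<noteq> 0" using l_nonzero by auto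
  have av: "a i \<bullet> v = 0" for i using a_l[of i] c cv by simp
  obtain x where x: "x \<in> X" using X_nonempty by blast
  have "x + real n *\<^sub>R v \<in> X" for n
    using x v B_lattice av unfolding X_eq
    by (auto simp: inner_add_right intro!: int_lattice_add int_lattice_scaleR)
  moreover have "inj (\<lambda>n. x + real n *\<^sub>R v)"
    using cv by (auto intro!: injI)
  ultimately have "infinite X"
    by (meson finite_subset image_subsetI range_inj_infinite)
  then show False using finite_X by simp
qed

text \<open>Near \<open>p\<close> there is a \<open>y\<close> in the translate whose value
  \<open>v \<bullet> y\<close> does not occur on the finite set \<open>X\<close>. Density gives a
  lattice point of the translate that is close to \<open>y\<close> up to a multiple of
  \<open>l\<close>. Neither the \<open>a i\<close> nor \<open>v\<close> see that multiple, so the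
  point lies in \<open>X\<close> with a forbidden value.\<close>

lemma strict_point_in_fiber_impossible:
  assumes x0: "x0 \<in> int_lattice" and p: "p \<in> P" "p - x0 \<in> W"
    and strict: "\<And>i. i \<in> J \<Longrightarrow> a i \<bullet> p < b i"
  shows False
proof -
  define O1 where "O1 = (\<Inter>i\<in>J. {y. a i \<bullet> y < b i})"
  have openO1: "open O1"
    unfolding O1_def by (intro open_INT ballI finite) (auto simp: open_halfspace_lt)
  have pO: "p \<in> O1" using strict by (auto simp: O1_def)
  obtain v where v: "v \<in> W" "v \<noteq> 0" "l \<bullet> v = 0"
  proof -
    have "dim {l} < dim W"
      using card_B_ge_2 dim_W l_nonzero by (simp add: dim_singleton)
    moreover have "span {l} \<subseteq> span W"
      by (intro span_mono) (simp add: l_W)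
    ultimately have "span {l} \<subset> span W"
      by (metis dim_span order.strict_iff_order less_irrefl)
    then obtain v where "v \<noteq> 0" "v \<in> span W" "\<And>y. y \<in> span {l} \<Longrightarrow> orthogonal v y"
      using orthogonal_to_subspace_exists_gen by metis
    moreover have "span W = W" by (simp add: subspace_W)
    moreover have "l \<in> span {l}" by (simp add: span_base)
    ultimately show ?thesis
      using that by (metis orthogonal_def inner_commute)
  qed
  let ?V = "(\<lambda>x. v \<bullet> x) ` X"
  obtain r where r: "r > 0" "ball p r \<subseteq> O1"
    using openO1 pO openE by blast
  obtain s where s: "0 < s" "s < r / norm v" "v \<bullet> (p + s *\<^sub>R v) \<notin> ?V"
  proof -
    have inj: "inj (\<lambda>s. v \<bullet> (p + s *\<^sub>R v))"
      using v by (auto intro!: injI simp: inner_add_right)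
    have "finite ((\<lambda>s. v \<bullet> (p + s *\<^sub>R v)) -` ?V)"
      by (rule finite_vimageI[OF _ inj]) (simp add: finite_X)
    moreover have "infinite {0<..<r / norm v}"
      using r v by (simp add: infinite_Ioo)
    ultimately have "\<exists>s. s \<in> {0<..<r / norm v} \<and> s \<notin> (\<lambda>s. v \<bullet> (p + s *\<^sub>R v)) -` ?V"
      by (meson finite_subset subsetI)
    then show ?thesis using that by auto
  qed
  define y where "y = p + s *\<^sub>R v"
  have "dist p y < r"
    using s v by (simp add: y_def dist_norm field_simps)
  then have yO: "y \<in> O1" using r by auto
  define O2 where "O2 = O1 \<inter> (\<lambda>x. v \<bullet> x) -` (- ?V)"
  have "open ((\<lambda>x. v \<bullet> x) -` (- ?V))"
    by (intro open_vimage continuous_intros) (simp add: open_Compl finite_imp_closed finite_X)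
  then have "open O2" by (simp add: O2_def openO1 open_Int)
  moreover have "y \<in> O2" using yO s by (simp add: O2_def y_def)
  ultimately obtain \<epsilon> where \<epsilon>: "\<epsilon> > 0" "ball y \<epsilon> \<subseteq> O2"
    using openE by blast
  have "y - x0 = (p - x0) + s *\<^sub>R v" by (simp add: y_def)
  also have "\<dots> \<in> span B"
    using p(2) v(1) unfolding W_def by (intro span_add span_scale)
  finally have "y - x0 \<in> span B" .
  then obtain z t where z: "z \<in> int_lattice" "z \<in> span B" "norm (z + t *\<^sub>R l - (y - x0)) < \<epsilon>"
    using lattice_plus_line_dense[OF B_lattice B_indep l_span B_minimal _ \<epsilon>(1)] by metis
  have "x0 + z + t *\<^sub>R l \<in> ball y \<epsilon>"
    using z(3) by (simp add: dist_norm norm_minus_commute algebra_simps)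
  then have zO: "x0 + z + t *\<^sub>R l \<in> O2" using \<epsilon> by blast
  have "a i \<bullet> (x0 + z) \<le> b i" for i
  proof (cases "i \<in> J")
    case True
    then show ?thesis using zO a_l by (auto simp: O2_def O1_def inner_add_right)
  next
    case False
    then have "a i \<bullet> z = 0" "a i \<bullet> (p - x0) = 0"
      using z p by (auto simp: J_def W_def)
    moreover have "a i \<bullet> p \<le> b i" using p(1) by (simp add: P_def)
    ultimately show ?thesis by (simp add: inner_add_right inner_diff_right)
  qed
  then have "x0 + z \<in> X"
    using x0 z by (simp add: X_eq int_lattice_add)
  moreover have "v \<bullet> (x0 + z) = v \<bullet> (x0 + z + t *\<^sub>R l)"
    using v by (simp add: inner_add_right inner_commute)
  ultimately have "v \<bullet> (x0 + z + t *\<^sub>R l) \<in> ?V" by (metis imageI)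
  then show False using zO by (simp add: O2_def)
qed

text \<open>If each inequality in \<open>J\<close> were slack somewhere on the translate, averaging
  such points one inequality at a time would make all of \<open>J\<close> strict.\<close>

lemma tight_constraint_on_fiber:
  assumes x0: "x0 \<in> int_lattice" and p: "p \<in> P" "p - x0 \<in> W"
  shows "\<exists>i\<in>J. \<forall>q\<in>P. q - x0 \<in> W \<longrightarrow> a i \<bullet> q = b i"
proof (rule ccontr)
  assume no: "\<not> ?thesis"
  have "\<exists>q\<in>P. q - x0 \<in> W \<and> (\<forall>i\<in>K. a i \<bullet> q < b i)" if K: "K \<subseteq> J" for K
    using finite[of K] K
  proof (induction K rule: finite_induct)
    case empty
    then show ?case using p by blast
  next
    case (insert i K)
    then obtain q where q: "q \<in> P" "q - x0 \<in> W" "\<forall>i\<in>K. a i \<bullet> q < b i" by auto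
    have "\<exists>q'. q' \<in> P \<and> q' - x0 \<in> W \<and> a i \<bullet> q' \<noteq> b i"
      using no insert.prems by blast
    then obtain q' where q': "q' \<in> P" "q' - x0 \<in> W" "a i \<bullet> q' < b i"
      by (auto simp: P_def order_le_less)
    let ?m = "(1/2) *\<^sub>R q + (1/2) *\<^sub>R q'"
    have "?m \<in> P" using convex_P q q' by (intro convexD) auto
    moreover have "?m - x0 = (1/2) *\<^sub>R (q - x0) + (1/2) *\<^sub>R (q' - x0)"
      by (simp add: algebra_simps flip: scaleR_left.add)
    then have "?m - x0 \<in> W"
      using q q' subspace_W by (simp add: subspace_add subspace_scale)
    moreover have "\<forall>j\<in>insert i K. a j \<bullet> ?m < b j"
    proof
      fix j assume "j \<in> insert i K"
      then have "a j \<bullet> q < b j \<or> a j \<bullet> q' < b j" using q q' by auto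
      moreover have "a j \<bullet> q \<le> b j" "a j \<bullet> q' \<le> b j" using q q' by (auto simp: P_def)
      ultimately show "a j \<bullet> ?m < b j" by (auto simp: inner_add_right)
    qed
    ultimately show ?case by blast
  qed
  from this[of J] show False
    using strict_point_in_fiber_impossible[OF x0] by auto
qed

text \<open>Otherwise a short step from \<open>p\<close> along \<open>w\<close> makes every
  inequality in \<open>J\<close> strict.\<close>

lemma tight_constraint_in_direction:
  assumes x0: "x0 \<in> int_lattice" and p: "p \<in> P" "p - x0 \<in> W" and w: "w \<in> W"
  shows "\<exists>i\<in>J. a i \<bullet> p = b i \<and> a i \<bullet> w \<ge> 0"
proof (rule ccontr)
  assume no: "\<not> ?thesis"
  \<comment> \<open>For \<open>i\<close> in \<open>J\<close>, the default 1 covers the inequalities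
    that by \<open>no\<close> cannot be violated along \<open>w\<close>; the others lose at most
    half of their slack.\<close>
  define \<delta> where "\<delta> i = (if a i \<bullet> p = b i \<or> a i \<bullet> w \<le> 0 then 1 else (b i - a i \<bullet> p) / (2 * (a i \<bullet> w)))" for i
  have \<delta>_pos: "\<delta> i > 0" for i
  proof (cases "a i \<bullet> p = b i \<or> a i \<bullet> w \<le> 0")
    case False
    then have "a i \<bullet> p < b i" "a i \<bullet> w > 0" using p by (auto simp: P_def order_le_less)
    then show ?thesis by (simp add: \<delta>_def)
  qed (simp add: \<delta>_def)
  define \<epsilon> where "\<epsilon> = Min (range \<delta>)"
  have \<epsilon>: "\<epsilon> > 0" "\<epsilon> \<le> \<delta> i" for i using \<delta>_pos by (auto simp: \<epsilon>_def)
  let ?q = "p + \<epsilon> *\<^sub>R w"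
  have J: "a i \<bullet> ?q < b i" if "i \<in> J" for i
  proof (cases "a i \<bullet> p = b i")
    case True
    then have "a i \<bullet> w < 0" using no that by force
    then show ?thesis using True \<epsilon>(1) by (simp add: inner_add_right mult_pos_neg)
  next
    case False
    then have lt: "a i \<bullet> p < b i" using p by (auto simp: P_def order_le_less)
    show ?thesis
    proof (cases "a i \<bullet> w \<le> 0")
      case True
      then have "\<epsilon> * (a i \<bullet> w) \<le> 0" using \<epsilon>(1) by (simp add: mult_nonneg_nonpos)
      then show ?thesis using lt by (simp add: inner_add_right)
    next
      case False
      then have "\<epsilon> * (a i \<bullet> w) \<le> (b i - a i \<bullet> p) / 2"
        using \<epsilon>(2)[of i] lt by (simp add: \<delta>_def field_simps)
      then show ?thesis using lt by (simp add: inner_add_right)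
    qed
  qed
  have "a i \<bullet> ?q \<le> b i" for i
  proof (cases "i \<in> J")
    case True
    then show ?thesis using J less_imp_le by blast
  next
    case False
    then show ?thesis using w p by (auto simp: J_def P_def inner_add_right)
  qed
  then have "?q \<in> P" by (simp add: P_def)
  moreover have q: "?q - x0 = (p - x0) + \<epsilon> *\<^sub>R w" by simp
  have "?q - x0 \<in> W" unfolding q using p w subspace_W by (simp add: subspace_add subspace_scale)
  ultimately show False using strict_point_in_fiber_impossible[OF x0] J by blast
qed

section \<open>Dimension bounds within one translate\<close>

lemma subspace_kernel: "subspace (W \<inter> {x. a i \<bullet> x = 0})"
  by (rule subspace_inter[OF subspace_W subspace_hyperplane])

lemma dim_kernel_in_W:
  assumes "i \<in> J"
  shows "dim (W \<inter> {x. a i \<bullet> x = 0}) \<le> card B - 1"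
proof -
  have "W \<inter> {x. a i \<bullet> x = 0} \<subset> W" using assms by (auto simp: J_def)
  moreover have "span W = W" "span (W \<inter> {x. a i \<bullet> x = 0}) = W \<inter> {x. a i \<bullet> x = 0}"
    by (simp_all only: span_eq_iff subspace_W subspace_kernel)
  ultimately have "dim (W \<inter> {x. a i \<bullet> x = 0}) < dim W"
    by (intro dim_psubset) (simp only:)
  then show ?thesis by (simp add: dim_W)
qed

text \<open>A rational subspace of \<open>W\<close> of codimension one cannot contain \<open>l\<close>.\<close>

lemma dim_lattice_directions_in_kernel:
  assumes "i \<in> J" "D \<subseteq> int_lattice" "D \<subseteq> W \<inter> {x. a i \<bullet> x = 0}"
  shows "dim D + 2 \<le> card B"
proof (rule ccontr)
  assume "\<not> ?thesis"
  then have "dim D \<ge> card B - 1" using card_B_ge_2 by linarith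
  let ?K = "W \<inter> {x. a i \<bullet> x = 0}"
  have "dim (span D) = dim ?K"
    using dim_kernel_in_W[OF assms(1)] dim_subset[OF assms(3)] \<open>dim D \<ge> card B - 1\<close> by simp
  then have "span D = ?K"
    using assms subspace_kernel[of i] by (intro subspace_dim_equal span_minimal) auto
  then have "l \<in> span D" using l_W a_l by simp
  then have "card B \<le> dim D" using B_minimal assms by blast
  also have "\<dots> \<le> card B - 1" using dim_subset[OF assms(3)] dim_kernel_in_W[OF assms(1)] by simp
  finally show False using card_B_ge_2 by simp
qed

text \<open>The differences are lattice vectors in the kernel of the inequality tight on this
  translate.\<close>

lemma dim_fiber:
  assumes "x \<in> X"
  shows "dim {y - x |y. y \<in> X \<and> y - x \<in> W} + 2 \<le> card B"
proof -
  obtain i where i: "i \<in> J" "\<forall>q\<in>P. q - x \<in> W \<longrightarrow> a i \<bullet> q = b i"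
    using tight_constraint_on_fiber[of x x] assms subspace_W X_P by (auto simp: subspace_0)
  have "a i \<bullet> x = b i"
    using i(2) assms subspace_W X_P by (auto simp: subspace_0)
  then show ?thesis
    using i assms
    by (intro dim_lattice_directions_in_kernel[OF i(1)])
       (auto simp: X_P int_lattice_diff inner_diff_right)
qed

lemma J_nonzero: "i \<in> J \<Longrightarrow> a i \<noteq> 0"
  by (auto simp: J_def)

lemma X_not_in_hyperplane:
  assumes "n \<noteq> 0" "\<And>x. x \<in> X \<Longrightarrow> n \<bullet> x = c"
  shows False
proof -
  have "affine hull X \<subseteq> {x. n \<bullet> x = c}"
    using assms by (intro hull_minimal) (auto simp: affine_hyperplane)
  then have all: "n \<bullet> x = c" for x using affine_hull_X by auto
  have "n \<bullet> n = 0" using all[of 0] all[of n] by simp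
  then show False using assms(1) by simp
qed

end

subsection \<open>Rational subspaces of codimension at most one\<close>

lemma finite_int_lattice_bounded: "finite {x \<in> (int_lattice :: (real ^ 'd) set). norm x \<le> R}"
proof -
  let ?F = "{z :: real. z \<in> \<int> \<and> \<bar>z\<bar> \<le> R}"
  have "{x \<in> (int_lattice :: (real ^ 'd) set). norm x \<le> R} \<subseteq> vec_lambda ` (UNIV \<rightarrow>\<^sub>E ?F)"
  proof
    fix x :: "real ^ 'd" assume x: "x \<in> {x \<in> int_lattice. norm x \<le> R}"
    have "x $ i \<in> ?F" for i
    proof -
      have "x $ i \<in> \<int>" using x by (simp add: int_lattice_def)
      moreover have "\<bar>x $ i\<bar> \<le> R"
        by (rule order_trans[OF component_le_norm_cart]) (use x in simp)
      ultimately show ?thesis by blast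
    qed
    then have "vec_nth x \<in> UNIV \<rightarrow>\<^sub>E ?F" by (rule PiE_I) simp
    then show "x \<in> vec_lambda ` (UNIV \<rightarrow>\<^sub>E ?F)"
      by (rule image_eqI[rotated]) simp
  qed
  moreover have "finite (UNIV \<rightarrow>\<^sub>E ?F :: ('d \<Rightarrow> real) set)"
    using finite_abs_int_segment[of R] by (intro finite_PiE) auto
  ultimately show ?thesis by (meson finite_subset finite_imageI)
qed

lemma dim_Un_le: "dim (S \<union> T) \<le> dim S + dim (T :: 'a::euclidean_space set)"
proof -
  obtain A where A: "independent A" "S \<subseteq> span A" "card A = dim S" using basis_exists by blast
  obtain C where C: "independent C" "T \<subseteq> span C" "card C = dim T" using basis_exists by blast
  have "S \<union> T \<subseteq> span (A \<union> C)"
    using A C span_mono[of A "A \<union> C"] span_mono[of C "A \<union> C"] by blast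
  then have "dim (S \<union> T) \<le> card (A \<union> C)"
    using A C by (intro dim_le_card) (auto simp: independent_imp_finite)
  also have "\<dots> \<le> card A + card C" by (rule card_Un_le)
  finally show ?thesis using A C by simp
qed

context flat_description begin

lemma dim_differences:
  assumes "\<And>y. y \<in> X \<Longrightarrow> y - x \<in> span S"
  shows "dim S = CARD('d)"
proof (rule ccontr)
  assume "dim S \<noteq> CARD('d)"
  then have "dim S < DIM(real ^ 'd)" using dim_subset_UNIV[of S] by simp
  then obtain n where n: "n \<noteq> 0" "\<And>y. y \<in> span S \<Longrightarrow> orthogonal n y"
    using orthogonal_to_subspace_exists by blast
  have "n \<bullet> y = n \<bullet> x" if "y \<in> X" for y
    using n(2)[OF assms[OF that]] by (simp add: orthogonal_def inner_diff_right)
  then show False using X_not_in_hyperplane n(1) by blast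
qed

text \<open>If \<open>W\<close> were the whole space, \<open>X\<close> would lie in one translate,
  where \<open>dim_fiber\<close> denies it full dimension.\<close>

lemma card_B_less: "card B < CARD('d)"
proof (rule ccontr)
  assume "\<not> card B < CARD('d)"
  then have "dim W = DIM(real ^ 'd)"
    using dim_W dim_subset_UNIV[of W] by simp
  then have W: "W = UNIV"
    using dim_eq_full[of W] subspace_W span_eq_iff by metis
  obtain x where x: "x \<in> X" using X_nonempty by blast
  have "dim {y - x |y. y \<in> X \<and> y - x \<in> W} = CARD('d)"
    by (rule dim_differences[of x]) (auto simp: W intro: span_base)
  then show False
    using dim_fiber[OF x] dim_subset_UNIV[of W] by (simp add: dim_W)
qed

text \<open>The segment from \<open>u\<close> to \<open>v\<close> meets the translate through
  \<open>z\<close> in a point of \<open>P\<close>, where there is no slack. The slack at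
  \<open>v\<close> is nonnegative and the weight \<open>t\<close> of \<open>u\<close> is positive,
  so \<open>u\<close> has no slack either.\<close>

lemma tight_across_hyperplane:
  assumes W: "W = {x. n \<bullet> x = 0}"
    and tight: "\<forall>q\<in>P. q - z \<in> W \<longrightarrow> a i \<bullet> q = b i"
    and uv: "u \<in> P" "v \<in> P" "n \<bullet> u \<le> n \<bullet> z" "n \<bullet> z < n \<bullet> v"
  shows "a i \<bullet> u = b i"
proof (rule ccontr)
  assume "a i \<bullet> u \<noteq> b i"
  then have lt: "a i \<bullet> u < b i" using uv(1) by (auto simp: P_def order_le_less)
  have le: "a i \<bullet> v \<le> b i" using uv(2) by (auto simp: P_def)
  define t where "t = (n \<bullet> v - n \<bullet> z) / (n \<bullet> v - n \<bullet> u)"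
  have t: "0 < t" "t \<le> 1" "t * (n \<bullet> v - n \<bullet> u) = n \<bullet> v - n \<bullet> z" using uv by (auto simp: t_def)
  let ?q = "t *\<^sub>R u + (1 - t) *\<^sub>R v"
  have "?q \<in> P" using convex_P uv t by (intro convexD) auto
  moreover have "n \<bullet> ?q = n \<bullet> z"
    using t(3) by (simp add: inner_add_right algebra_simps)
  ultimately have "a i \<bullet> ?q = b i" using tight W by (simp add: inner_diff_right)
  moreover have "t * (a i \<bullet> u) < t * b i" using lt t by simp
  moreover have "(1 - t) * (a i \<bullet> v) \<le> (1 - t) * b i" using le t by (intro mult_left_mono) auto
  ultimately show False by (simp add: inner_add_right algebra_simps)
qed

text \<open>The inequality tight at the level of \<open>z\<close> would be tight on all of
  \<open>X\<close>: points above that level are compared with \<open>x\<close>, the others with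
  \<open>y\<close>.\<close>

lemma no_intermediate_level:
  assumes W: "W = {x. n \<bullet> x = 0}"
    and X: "x \<in> X" "y \<in> X" "z \<in> X" and less: "n \<bullet> x < n \<bullet> z" "n \<bullet> z < n \<bullet> y"
  shows False
proof -
  obtain i where i: "i \<in> J" "\<forall>q\<in>P. q - z \<in> W \<longrightarrow> a i \<bullet> q = b i"
    using tight_constraint_on_fiber[of z z] X subspace_W by (auto simp: X_P subspace_0)
  have W': "W = {x. (- n) \<bullet> x = 0}" using W by simp
  have "a i \<bullet> u = b i" if u: "u \<in> X" for u
  proof (cases "n \<bullet> u \<le> n \<bullet> z")
    case True
    then show ?thesis
      using tight_across_hyperplane[OF W i(2), of u y] u X less by (simp add: X_P)
  next
    case False
    then show ?thesis
      using tight_across_hyperplane[OF W' i(2), of u x] u X less by (simp add: X_P)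
  qed
  then show False using X_not_in_hyperplane J_nonzero[OF i(1)] by blast
qed

text \<open>Only the two extreme levels occur, so the directions of \<open>X\<close> span at most
  \<open>2 * (card B - 2) + 1\<close> dimensions.\<close>

lemma dim_ge_5_if_codim_1:
  assumes "card B + 1 = CARD('d)"
  shows "CARD('d) \<ge> 5"
proof -
  obtain C where C: "finite C" "card C = CARD('d) - dim W" "W = {x. \<forall>c\<in>C. c \<bullet> x = 0}"
    using subspace_eq_orthogonal_to_finite[OF subspace_W] by auto
  then have "card C = 1" using assms dim_W by simp
  then obtain n where "C = {n}" by (auto simp: card_1_singleton_iff)
  then have W: "W = {x. n \<bullet> x = 0}" using C by simp
  define x where "x = arg_min_on ((\<bullet>) n) X"
  define y where "y = arg_min_on ((\<bullet>) (- n)) X"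
  have x: "x \<in> X" "\<And>u. u \<in> X \<Longrightarrow> n \<bullet> x \<le> n \<bullet> u"
    unfolding x_def using finite_X X_nonempty by (auto intro: arg_min_if_finite arg_min_least)
  have y: "y \<in> X" "\<And>u. u \<in> X \<Longrightarrow> (- n) \<bullet> y \<le> (- n) \<bullet> u"
    unfolding y_def using finite_X X_nonempty by (blast intro: arg_min_if_finite arg_min_least)+
  let ?D = "\<lambda>x. {u - x |u. u \<in> X \<and> u - x \<in> W}"
  let ?S = "?D x \<union> (?D y \<union> {y - x})"
  have "u - x \<in> span ?S" if u: "u \<in> X" for u
  proof -
    have "n \<bullet> u = n \<bullet> x \<or> n \<bullet> u = n \<bullet> y"
    proof -
      have "\<not> (n \<bullet> x < n \<bullet> u \<and> n \<bullet> u < n \<bullet> y)"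
        using no_intermediate_level[OF W x(1) y(1) u] by blast
      moreover have "n \<bullet> x \<le> n \<bullet> u" "n \<bullet> u \<le> n \<bullet> y" using x(2)[OF u] y(2)[OF u] by auto
      ultimately show ?thesis by linarith
    qed
    then have "u - x \<in> W \<or> u - y \<in> W" by (auto simp: W inner_diff_right)
    then show ?thesis
    proof
      assume "u - x \<in> W"
      then show ?thesis using u by (intro span_base) blast
    next
      assume "u - y \<in> W"
      then have "u - y \<in> span ?S" "y - x \<in> span ?S" using u by (blast intro: span_base)+
      then have "(u - y) + (y - x) \<in> span ?S" by (rule span_add)
      then show ?thesis by simp
    qed
  qed
  then have "CARD('d) = dim ?S" using dim_differences[of x ?S] by simp
  also have "\<dots> \<le> dim (?D x) + (dim (?D y) + dim {y - x})"
    using dim_Un_le[of "?D x" "?D y \<union> {y - x}"] dim_Un_le[of "?D y" "{y - x}"] by linarith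
  also have "dim {y - x} \<le> 1" by (simp add: dim_singleton)
  finally show ?thesis
    using dim_fiber[OF x(1)] dim_fiber[OF y(1)] assms by linarith
qed

end

subsection \<open>Parity modulo a rational plane\<close>

lemma int_lattice_inner_nat:
  assumes "x \<in> int_lattice"
  obtains k :: nat where "x \<bullet> x = real k"
proof -
  have "x \<bullet> x \<in> \<int>"
    using assms by (auto simp: inner_vec_def int_lattice_def)
  then obtain k :: int where "x \<bullet> x = of_int k" by (auto elim: Ints_cases)
  moreover have "x \<bullet> x \<ge> 0" by simp
  ultimately have "x \<bullet> x = real (nat k)" by simp
  then show ?thesis by (rule that)
qed

lemma half_diff_in_int_lattice:
  assumes "x \<in> int_lattice" "y \<in> int_lattice"
    and "{i. odd \<lfloor>x $ i\<rfloor>} = {i. odd \<lfloor>y $ i\<rfloor>}"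
  shows "(1/2) *\<^sub>R (x - y) \<in> int_lattice"
  unfolding int_lattice_def
proof (intro CollectI allI)
  fix i
  have "x $ i \<in> \<int>" "y $ i \<in> \<int>" using assms by (auto simp: int_lattice_def)
  then obtain k m :: int where km: "x $ i = of_int k" "y $ i = of_int m"
    by (meson Ints_cases)
  then have "odd k \<longleftrightarrow> odd m" using assms(3)[THEN eqset_imp_iff, of i] by simp
  then have "even (k - m)" by simp
  then obtain r where "k - m = 2 * r" by (rule evenE)
  then have "real_of_int k - real_of_int m = 2 * real_of_int r"
    by (metis of_int_diff of_int_mult of_int_numeral)
  then have "((1/2) *\<^sub>R (x - y)) $ i = of_int r" using km by simp
  then show "((1/2) *\<^sub>R (x - y)) $ i \<in> \<int>" by simp
qed

text \<open>A linearly independent pair of minimal total length has this property,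
  since halving would shorten it.\<close>

lemma plane_pair_independent_mod_2:
  fixes B :: "(real ^ 'd) set"
  assumes B: "B \<subseteq> int_lattice" "independent B" "card B = 2"
  obtains u v where "u \<in> int_lattice" "v \<in> int_lattice" "u \<in> span B" "v \<in> span B"
    "(1/2) *\<^sub>R u \<notin> int_lattice" "(1/2) *\<^sub>R v \<notin> int_lattice" "(1/2) *\<^sub>R (u + v) \<notin> int_lattice"
proof -
  define Q where "Q = (\<lambda>(u, v). u \<in> int_lattice \<and> v \<in> int_lattice \<and> u \<in> span B \<and> v \<in> span B \<and>
    (\<forall>c d. c *\<^sub>R u + d *\<^sub>R v = 0 \<longrightarrow> c = 0 \<and> d = (0::real)))"
  \<comment> \<open>Squared lengths of lattice vectors are natural numbers, so rounding loses
    nothing and a least pair exists.\<close>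
  define f where "f = (\<lambda>(u :: real ^ 'd, v :: real ^ 'd). nat \<lfloor>u \<bullet> u + v \<bullet> v\<rfloor>)"
  obtain p q where pq: "B = {p, q}" "p \<noteq> q" using B by (auto simp: card_2_iff)
  have "c = 0 \<and> d = 0" if "c *\<^sub>R p + d *\<^sub>R q = 0" for c d
  proof -
    let ?u = "\<lambda>x. if x = p then c else d"
    have "(\<Sum>x\<in>B. ?u x *\<^sub>R x) = 0" using that pq by simp
    then have "?u x = 0" if "x \<in> B" for x
      using independentD[OF B(2) _ subset_refl _ that, of ?u] pq by simp
    from this[of p] this[of q] show ?thesis using pq by auto
  qed
  then have "Q (p, q)"
    using B pq by (auto simp: Q_def intro: span_base)
  then obtain w where w: "Q w" "\<And>w'. Q w' \<Longrightarrow> f w \<le> f w'"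
    using ex_has_least_nat[of Q "(p, q)" f] by blast
  obtain u v where uv: "w = (u, v)" by (cases w)
  have Q: "u \<in> int_lattice" "v \<in> int_lattice" "u \<in> span B" "v \<in> span B"
    and ind: "\<And>c d. c *\<^sub>R u + d *\<^sub>R v = 0 \<Longrightarrow> c = 0 \<and> d = 0"
    using w uv by (auto simp: Q_def)
  have min: "u \<bullet> u + v \<bullet> v \<le> u' \<bullet> u' + v' \<bullet> v'" if "Q (u', v')" for u' v'
  proof -
    have "u' \<in> int_lattice" "v' \<in> int_lattice" using that by (auto simp: Q_def)
    then obtain k1 k2 k3 k4 where "u \<bullet> u = real k1" "v \<bullet> v = real k2" "u' \<bullet> u' = real k3" "v' \<bullet> v' = real k4"
      using Q(1,2) int_lattice_inner_nat by metis
    moreover have "f (u, v) \<le> f (u', v')" using w uv that by simp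
    ultimately show ?thesis by (simp add: f_def flip: of_nat_add)
  qed
  have nz: "u \<noteq> 0" "v \<noteq> 0" "u \<noteq> v"
    using ind[of 1 0] ind[of 0 1] ind[of 1 "-1"] by auto
  show thesis
  proof (rule that[OF Q])
    show "(1/2) *\<^sub>R u \<notin> int_lattice"
    proof
      assume "(1/2) *\<^sub>R u \<in> int_lattice"
      moreover have "c = 0 \<and> d = 0" if "c *\<^sub>R (1/2) *\<^sub>R u + d *\<^sub>R v = 0" for c d
        using ind[of "c * (1/2)" d] that by simp
      ultimately have "Q ((1/2) *\<^sub>R u, v)" using Q by (auto simp: Q_def span_scale)
      from min[OF this] show False using nz inner_gt_zero_iff[of u] by simp
    qed
    show "(1/2) *\<^sub>R v \<notin> int_lattice"
    proof
      assume "(1/2) *\<^sub>R v \<in> int_lattice"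
      moreover have "c = 0 \<and> d = 0" if "c *\<^sub>R u + d *\<^sub>R (1/2) *\<^sub>R v = 0" for c d
        using ind[of c "d * (1/2)"] that by simp
      ultimately have "Q (u, (1/2) *\<^sub>R v)" using Q by (auto simp: Q_def span_scale)
      from min[OF this] show False using nz inner_gt_zero_iff[of v] by simp
    qed
    show "(1/2) *\<^sub>R (u + v) \<notin> int_lattice"
    proof
      let ?h = "(1/2) *\<^sub>R (u + v)"
      assume h: "?h \<in> int_lattice"
      have hs: "?h \<in> span B" using Q by (intro span_scale span_add)
      have 1: "c = 0 \<and> d = 0" if "c *\<^sub>R ?h + d *\<^sub>R v = 0" for c d
        using ind[of "c / 2" "c / 2 + d"] that by (simp add: algebra_simps)
      have 2: "c = 0 \<and> d = 0" if "c *\<^sub>R u + d *\<^sub>R ?h = 0" for c d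
        using ind[of "c + d / 2" "d / 2"] that by (simp add: algebra_simps)
      have "Q (?h, v)" "Q (u, ?h)" using Q h hs 1 2 by (auto simp: Q_def)
      from this[THEN min] have "u \<bullet> u \<le> ?h \<bullet> ?h" "v \<bullet> v \<le> ?h \<bullet> ?h" by auto
      \<comment> \<open>By the parallelogram identity, \<open>?h\<close> is shorter than the longer
        of \<open>u\<close> and \<open>v\<close>.\<close>
      moreover have "4 * (?h \<bullet> ?h) = 2 * (u \<bullet> u) + 2 * (v \<bullet> v) - (u - v) \<bullet> (u - v)"
        by (simp add: inner_add_left inner_add_right inner_diff_left inner_diff_right inner_commute)
      moreover have "(u - v) \<bullet> (u - v) > 0" using nz by simp
      ultimately show False by linarith
    qed
  qed
qed

text \<open>A rational plane meets the lattice in four of the sixteen parity classes,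
  so it leaves only four classes of fibers.\<close>

lemma midpoint_in_lattice_fiber:
  fixes B :: "(real ^ 'd) set"
  assumes d: "CARD('d) = 4" and B: "B \<subseteq> int_lattice" "independent B" "card B = 2"
    and A: "card A = 5" "\<And>p. p \<in> A \<Longrightarrow> \<exists>x\<in>int_lattice. p - x \<in> span B"
  obtains p q x where "p \<in> A" "q \<in> A" "p \<noteq> q" "x \<in> int_lattice" "(1/2) *\<^sub>R (p + q) - x \<in> span B"
proof -
  obtain u v where uv: "u \<in> int_lattice" "v \<in> int_lattice" "u \<in> span B" "v \<in> span B"
    "(1/2) *\<^sub>R u \<notin> int_lattice" "(1/2) *\<^sub>R v \<notin> int_lattice" "(1/2) *\<^sub>R (u + v) \<notin> int_lattice"
    using plane_pair_independent_mod_2[OF B] by blast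
  obtain r where r: "\<And>p. p \<in> A \<Longrightarrow> r p \<in> int_lattice" "\<And>p. p \<in> A \<Longrightarrow> p - r p \<in> span B"
    using A(2) by metis
  define V where "V = {0, u, v, u + v}"
  have uv_minus: "(1/2) *\<^sub>R (u - v) \<notin> int_lattice"
  proof
    assume "(1/2) *\<^sub>R (u - v) \<in> int_lattice"
    from int_lattice_add[OF this uv(2)] have "(1/2) *\<^sub>R (u - v) + v \<in> int_lattice" .
    moreover have "(1/2) *\<^sub>R (u - v) + v = (1/2) *\<^sub>R (u + v)"
      by (simp add: vec_eq_iff field_simps)
    ultimately show False using uv by simp
  qed
  have neg: "(1/2) *\<^sub>R (x - y) \<in> int_lattice \<Longrightarrow> (1/2) *\<^sub>R (y - x) \<in> int_lattice" for x y :: "real ^ 'd"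
    using int_lattice_diff[OF int_lattice_0, of "(1/2) *\<^sub>R (x - y)"] by (simp add: scaleR_diff_right)
  \<comment> \<open>The four elements of \<open>V\<close> are pairwise incongruent modulo 2.\<close>
  have V_half: "w = w'" if "w \<in> V" "w' \<in> V" "(1/2) *\<^sub>R (w - w') \<in> int_lattice" for w w'
    using that uv uv_minus neg[OF that(3)] by (auto simp: V_def)
  have "u \<noteq> 0" "v \<noteq> 0" "u + v \<noteq> 0" "u \<noteq> v"
    using uv uv_minus int_lattice_0 by auto
  then have cardV: "card V = 4" by (auto simp: V_def)
  have V: "w \<in> int_lattice" "w \<in> span B" if "w \<in> V" for w
    using that uv by (auto simp: V_def int_lattice_0 int_lattice_add span_zero span_add)
  define \<phi> where "\<phi> = (\<lambda>(p, w). {i. odd \<lfloor>(r p + w) $ i\<rfloor>})"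
  have finA: "finite A" using A(1) card.infinite by fastforce
  \<comment> \<open>Twenty pairs fall into sixteen parity classes.\<close>
  have "\<not> inj_on \<phi> (A \<times> V)"
  proof
    assume "inj_on \<phi> (A \<times> V)"
    then have "card (A \<times> V) \<le> card (Pow (UNIV :: 'd set))"
      by (rule card_inj_on_le) auto
    then show False using A cardV d by (simp add: card_cartesian_product card_Pow)
  qed
  then obtain p w q w' where pq: "p \<in> A" "q \<in> A" "w \<in> V" "w' \<in> V" "(p, w) \<noteq> (q, w')" "\<phi> (p, w) = \<phi> (q, w')"
    by (auto simp: inj_on_def)
  have rpq: "r p \<in> int_lattice" "r q \<in> int_lattice" "p - r p \<in> span B" "q - r q \<in> span B"
    using r pq by auto
  let ?z = "(1/2) *\<^sub>R ((r p + w) - (r q + w'))"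
  have z: "?z \<in> int_lattice"
    using rpq pq V by (intro half_diff_in_int_lattice int_lattice_add) (auto simp: \<phi>_def)
  have "p \<noteq> q"
  proof
    assume "p = q"
    then have "(1/2) *\<^sub>R (w - w') \<in> int_lattice" using z by simp
    then show False using V_half pq \<open>p = q\<close> by blast
  qed
  \<comment> \<open>\<open>r q + ?z\<close> is the midpoint of \<open>r p\<close> and
    \<open>r q\<close>, shifted within the plane by half of \<open>w - w'\<close>.\<close>
  moreover have "(1/2) *\<^sub>R (p + q) - (r q + ?z)
      = (1/2) *\<^sub>R (((p - r p) + (q - r q)) - (w - w'))"
    by (simp add: vec_eq_iff field_simps)
  moreover have "(1/2) *\<^sub>R (((p - r p) + (q - r q)) - (w - w')) \<in> span B"
    by (intro span_scale span_diff[OF span_add[OF rpq(3,4)] span_diff] V pq)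
  moreover have "r q + ?z \<in> int_lattice" using rpq z by (intro int_lattice_add)
  ultimately show thesis using that[of p q "r q + ?z"] pq by simp
qed

subsection \<open>Rational planes in dimension four\<close>

context flat_description begin

text \<open>The point itself need not be integral; its image modulo \<open>W\<close> is a lattice
  point of the quotient.\<close>

definition lattice_fiber :: "real ^ 'd \<Rightarrow> bool" where
  "lattice_fiber p \<longleftrightarrow> (\<exists>x\<in>int_lattice. p - x \<in> W)"

text \<open>Rounding coordinates along \<open>B\<close> gives each fiber that meets the hull a
  lattice representative of bounded norm.\<close>

lemma finite_values_on_lattice_fibers:
  assumes g: "\<And>x y. x - y \<in> W \<Longrightarrow> g x = g y"
  shows "finite (g ` {p \<in> convex hull X. lattice_fiber p})"
proof -
  have "bounded (convex hull X)" using finite_X by (simp add: finite_imp_bounded bounded_convex_hull)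
  then obtain M where M: "\<And>p. p \<in> convex hull X \<Longrightarrow> norm p \<le> M" by (auto simp: bounded_iff)
  have finB: "finite B" using B_indep by (simp add: independent_imp_finite)
  let ?R = "M + (\<Sum>v\<in>B. norm v)"
  have "g ` {p \<in> convex hull X. lattice_fiber p} \<subseteq> g ` {x \<in> int_lattice. norm x \<le> ?R}"
  proof clarify
    fix p assume p: "p \<in> convex hull X" "lattice_fiber p"
    then obtain x where x: "x \<in> int_lattice" "p - x \<in> W" by (auto simp: lattice_fiber_def)
    then obtain c where c: "p - x = (\<Sum>v\<in>B. c v *\<^sub>R v)"
      by (auto simp: W_def span_finite[OF finB])
    let ?s = "\<Sum>v\<in>B. of_int \<lfloor>c v\<rfloor> *\<^sub>R v"
    have "?s \<in> W" unfolding W_def by (intro span_sum span_scale span_base)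
    have diff: "p - (x + ?s) = (\<Sum>v\<in>B. frac (c v) *\<^sub>R v)"
      using c by (simp add: frac_def scaleR_diff_left sum_subtractf algebra_simps)
    have "norm (p - (x + ?s)) \<le> (\<Sum>v\<in>B. norm v)"
      unfolding diff
    proof (rule sum_norm_le)
      fix v show "norm (frac (c v) *\<^sub>R v) \<le> norm v"
        using frac_lt_1[of "c v"] by (simp add: mult_left_le_one_le less_imp_le)
    qed
    then have "norm (x + ?s) \<le> ?R"
      using M[OF p(1)] norm_triangle_ineq4[of p "p - (x + ?s)"] by simp
    moreover have "x + ?s \<in> int_lattice"
      using x B_lattice by (intro int_lattice_add int_lattice_sum int_lattice_scaleR) auto
    moreover have "p - (x + ?s) \<in> W"
      using subspace_diff[OF subspace_W x(2) \<open>?s \<in> W\<close>] by (simp add: algebra_simps)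
    ultimately show "g p \<in> g ` {x \<in> int_lattice. norm x \<le> ?R}" using g by auto
  qed
  then show ?thesis using finite_int_lattice_bounded finite_subset by blast
qed

text \<open>If \<open>l\<close> were in this span, the two differences could take the place of
  \<open>B\<close>, and \<open>dim_fiber\<close> would make both of them zero.\<close>

lemma lattice_directions_dependent:
  assumes "x \<in> X" "y \<in> X" "z \<in> X" "y \<noteq> z" "independent {y - x, z - x}" "card B = 2"
  shows "l \<notin> span {y - x, z - x}"
proof
  assume l: "l \<in> span {y - x, z - x}"
  have card: "card {y - x, z - x} = 2" using assms by simp
  have lattice: "{y - x, z - x} \<subseteq> int_lattice"
    using assms(1-3) by (auto simp: X_P int_lattice_diff)
  have minimal: "card {y - x, z - x} \<le> dim S" if "S \<subseteq> int_lattice" "l \<in> span S" for S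
    using B_minimal[OF that] card assms(6) by simp
  interpret D: flat_description a b X l "{y - x, z - x}"
    by (rule flat_description.intro
        [OF X_eq finite_X affine_hull_X l_nonzero a_l lattice assms(5) l minimal])
  have "{y - x, z - x} \<subseteq> {u - x |u. u \<in> X \<and> u - x \<in> D.W}"
    using assms by (auto simp: D.W_def intro: span_base)
  then have "dim {y - x, z - x} \<le> dim {u - x |u. u \<in> X \<and> u - x \<in> D.W}"
    by (rule dim_subset)
  then show False
    using D.dim_fiber[OF assms(1)] card assms(5) by (simp add: dim_eq_card_independent)
qed

end

locale flat_description_codim_2 = flat_description a b X l B
  for a :: "'i::finite \<Rightarrow> real ^ 'd" and b X l B +
  fixes w :: "real ^ 'd"
  assumes card_d: "CARD('d) = 4" and card_B: "card B = 2"
    and w_W: "w \<in> W" and w_l: "w \<notin> span {l}"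
begin

lemma W_coordinates:
  assumes "u \<in> W"
  obtains \<alpha> \<beta> where "u = \<alpha> *\<^sub>R w + \<beta> *\<^sub>R l"
proof -
  have ind: "independent {w, l}"
    using w_l l_nonzero by (simp add: independent_insert)
  have "w \<noteq> l" using w_l span_base by blast
  then have "card {w, l} = 2" by simp
  then have "dim (span {w, l}) = dim W" using ind by (simp add: dim_eq_card_independent dim_W card_B)
  moreover have "span {w, l} \<subseteq> W" using w_W l_W subspace_W by (intro span_minimal) auto
  ultimately have "span {w, l} = W" using subspace_W by (intro subspace_dim_equal) auto
  then have "u \<in> span {w, l}" using assms by simp
  then obtain \<alpha> where "u - \<alpha> *\<^sub>R w \<in> span {l}" by (auto simp: span_breakdown_eq)
  then obtain \<beta> where "u - \<alpha> *\<^sub>R w = \<beta> *\<^sub>R l" by (auto simp: span_singleton)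
  then have "u = \<alpha> *\<^sub>R w + \<beta> *\<^sub>R l" by (simp add: algebra_simps)
  then show ?thesis by (rule that)
qed

lemma J_w: "i \<in> J \<Longrightarrow> a i \<bullet> w \<noteq> 0"
proof
  assume i: "i \<in> J" "a i \<bullet> w = 0"
  then obtain u where u: "u \<in> W" "a i \<bullet> u \<noteq> 0" by (auto simp: J_def)
  then show False using W_coordinates[OF u(1)] i a_l by (metis inner_add_right inner_scaleR_right mult_zero_right add_0)
qed

text \<open>The preimages in \<open>P\<close> of the edges of the image of \<open>P\<close> modulo \<open>W\<close>, as produced by
  Fourier--Motzkin elimination of \<open>w\<close>.\<close>

definition edge :: "'i \<Rightarrow> 'i \<Rightarrow> (real ^ 'd) set" where
  "edge i j = {p \<in> P. a i \<bullet> p = b i \<and> a j \<bullet> p = b j \<and> a i \<bullet> w > 0 \<and> a j \<bullet> w < 0}"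

text \<open>Tight inequalities for the directions \<open>w\<close> and \<open>- w\<close> bound the
  fiber from both sides; \<open>J_w\<close> makes the signs strict.\<close>

lemma in_edge:
  assumes "p \<in> P" "lattice_fiber p"
  obtains i j where "p \<in> edge i j"
proof -
  obtain x where x: "x \<in> int_lattice" "p - x \<in> W" using assms by (auto simp: lattice_fiber_def)
  have nw: "- w \<in> W" using w_W subspace_W by (simp add: subspace_neg)
  obtain i where i: "i \<in> J" "a i \<bullet> p = b i" "a i \<bullet> w \<ge> 0"
    using tight_constraint_in_direction[OF x(1) assms(1) x(2) w_W] by blast
  obtain j where j: "j \<in> J" "a j \<bullet> p = b j" "a j \<bullet> (- w) \<ge> 0"
    using tight_constraint_in_direction[OF x(1) assms(1) x(2) nw] by blast
  have "p \<in> edge i j"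
    using i j J_w[OF i(1)] J_w[OF j(1)] assms(1) by (simp add: edge_def)
  then show ?thesis by (rule that)
qed

lemma edge_midpoint:
  assumes "p \<in> P" "q \<in> P" "(1/2) *\<^sub>R (p + q) \<in> edge i j"
  shows "p \<in> edge i j" "q \<in> edge i j"
proof -
  have "a i \<bullet> p \<le> b i" "a i \<bullet> q \<le> b i" "a j \<bullet> p \<le> b j" "a j \<bullet> q \<le> b j"
    using assms by (auto simp: P_def)
  moreover have "a i \<bullet> p + a i \<bullet> q = 2 * b i" "a j \<bullet> p + a j \<bullet> q = 2 * b j"
    using assms(3) by (auto simp: edge_def inner_add_right)
  ultimately have "a i \<bullet> p = b i" "a i \<bullet> q = b i" "a j \<bullet> p = b j" "a j \<bullet> q = b j" by linarith+
  then show "p \<in> edge i j" "q \<in> edge i j" using assms by (auto simp: edge_def)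
qed

text \<open>The two inequalities have opposite signs on \<open>w\<close>, so \<open>s\<close> can
  differ from \<open>m\<close> only by a multiple of \<open>l\<close>.\<close>

lemma edge_fiber:
  assumes "m \<in> edge i j" "s \<in> P" "s - m \<in> W"
  shows "s \<in> edge i j"
proof -
  obtain \<alpha> \<beta> where "s - m = \<alpha> *\<^sub>R w + \<beta> *\<^sub>R l" using W_coordinates[OF assms(3)] .
  then have s: "s = m + \<alpha> *\<^sub>R w + \<beta> *\<^sub>R l" by (simp add: algebra_simps)
  have "a i \<bullet> s \<le> b i" "a j \<bullet> s \<le> b j" using assms(2) by (auto simp: P_def)
  then have "\<alpha> * (a i \<bullet> w) \<le> 0" "\<alpha> * (a j \<bullet> w) \<le> 0"
    using assms(1) by (auto simp: s edge_def inner_add_right a_l)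
  then have "\<alpha> = 0"
    using assms(1) by (auto simp: edge_def mult_le_0_iff)
  then show ?thesis using assms by (auto simp: edge_def s inner_add_right a_l)
qed

text \<open>The two normals are not parallel: as negative multiples of each other they would force
  \<open>X\<close> into a hyperplane.\<close>

lemma dim_edge_directions:
  assumes "p \<in> edge i j"
  shows "dim {x. a i \<bullet> x = 0 \<and> a j \<bullet> x = 0} \<le> 2"
proof -
  have w: "a i \<bullet> w > 0" "a j \<bullet> w < 0" using assms by (auto simp: edge_def)
  have not_multiple: "a j \<notin> span {a i}"
  proof
    assume "a j \<in> span {a i}"
    then obtain c where c: "a j = c *\<^sub>R a i" by (auto simp: span_singleton)
    then have "c < 0" using w by (auto simp: mult_less_0_iff)
    have "a i \<bullet> x = b i" if "x \<in> X" for x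
    proof -
      have "a i \<bullet> x \<le> b i" using that by (simp add: X_eq)
      moreover have "a j \<bullet> x \<le> a j \<bullet> p" using that assms by (simp add: X_eq edge_def)
      then have "c * (a i \<bullet> x) \<le> c * (a i \<bullet> p)" by (simp add: c)
      moreover have "a i \<bullet> p = b i" using assms by (simp add: edge_def)
      ultimately show ?thesis using \<open>c < 0\<close> by simp
    qed
    moreover have "a i \<noteq> 0" using w by auto
    ultimately show False using X_not_in_hyperplane by blast
  qed
  have "a i \<noteq> 0" using w by auto
  then have "independent {a j, a i}" using not_multiple by (simp add: independent_insert)
  moreover have "a j \<noteq> a i" using w by auto
  ultimately have dim2: "dim (span {a j, a i}) = 2" by (simp add: dim_eq_card_independent)
  have "{x. a i \<bullet> x = 0 \<and> a j \<bullet> x = 0} \<subseteq> {y \<in> UNIV. \<forall>x\<in>span {a j, a i}. orthogonal x y}"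
  proof clarsimp
    fix x v assume *: "a i \<bullet> x = 0" "a j \<bullet> x = 0" "v \<in> span {a j, a i}"
    have "orthogonal x v" by (rule orthogonal_to_span[OF *(3)]) (use * in \<open>auto simp: orthogonal_def inner_commute\<close>)
    then show "orthogonal v x" by (simp add: orthogonal_commute)
  qed
  then have "dim {x. a i \<bullet> x = 0 \<and> a j \<bullet> x = 0} \<le> dim {y \<in> UNIV. \<forall>x\<in>span {a j, a i}. orthogonal x y}"
    by (rule dim_subset)
  moreover have "dim {y \<in> UNIV. \<forall>x\<in>span {a j, a i}. orthogonal x y} + dim (span {a j, a i}) = 4"
    using dim_subspace_orthogonal_to_vectors[of "span {a j, a i}" UNIV] card_d by simp
  ultimately show ?thesis using dim2 by simp
qed

text \<open>Two independent differences would span all directions of the edge, among them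
  \<open>l\<close>.\<close>

lemma lattice_points_on_edge_collinear:
  assumes X: "x \<in> X" "y \<in> X" "z \<in> X" and e: "x \<in> edge i j" "y \<in> edge i j" "z \<in> edge i j"
    and "y \<noteq> z" and ind: "independent {y - x, z - x}"
  shows False
proof -
  let ?K = "{x. a i \<bullet> x = 0 \<and> a j \<bullet> x = 0}"
  have K: "?K = {x. a i \<bullet> x = 0} \<inter> {x. a j \<bullet> x = 0}" by auto
  have sub: "subspace ?K"
    unfolding K by (intro subspace_inter subspace_hyperplane)
  have "{y - x, z - x} \<subseteq> ?K" using e by (auto simp: edge_def inner_diff_right)
  moreover have "dim (span {y - x, z - x}) = 2"
    using ind \<open>y \<noteq> z\<close> by (simp add: dim_eq_card_independent)
  ultimately have "span {y - x, z - x} = ?K"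
    using sub dim_edge_directions[OF e(1)] by (intro subspace_dim_equal span_minimal) auto
  then have "l \<in> span {y - x, z - x}" using a_l by simp
  then show False
    using lattice_directions_dependent[OF X \<open>y \<noteq> z\<close> ind card_B] by simp
qed

section \<open>Five-point configurations and descent\<close>

lemma distinct_fibers:
  assumes "x \<in> X" "y \<in> X" "x - y \<in> W"
  shows "x = y"
proof -
  have "dim {u - y |u. u \<in> X \<and> u - y \<in> W} = 0" using dim_fiber[OF assms(2)] card_B by simp
  then have "{u - y |u. u \<in> X \<and> u - y \<in> W} \<subseteq> {0}" by (simp add: dim_eq_0)
  then show ?thesis using assms by auto
qed

text \<open>Modulo \<open>W\<close> these are five lattice points on the boundary of the image of
  \<open>P\<close>, no three on an edge. Integrality is asked only modulo \<open>W\<close>, so that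
  midpoints can be taken.\<close>

definition spread :: "(real ^ 'd) set \<Rightarrow> bool" where
  "spread A \<longleftrightarrow> card A = 5 \<and> A \<subseteq> convex hull X \<and> (\<forall>p\<in>A. lattice_fiber p) \<and>
    (\<forall>p\<in>A. \<forall>q\<in>A. p - q \<in> W \<longrightarrow> p = q) \<and> (\<forall>i j. card (A \<inter> edge i j) \<le> 2)"

text \<open>An affine basis chosen from \<open>X\<close> works: three of its points on one edge
  would be affinely independent.\<close>

lemma spread_exists: "\<exists>A. spread A"
proof -
  obtain A where A: "A \<subseteq> X" "\<not> affine_dependent A" "affine hull X = affine hull A"
    using affine_basis_exists by blast
  have "aff_dim A = 4"
    using A(3) affine_hull_X card_d by (metis aff_dim_UNIV aff_dim_affine_hull DIM_cart DIM_real mult.right_neutral of_nat_numeral)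
  then have "card A = 5" using aff_dim_affine_independent[OF A(2)] by simp
  moreover have "A \<subseteq> convex hull X" using A(1) hull_subset[of X convex] by (rule order_trans)
  moreover have "lattice_fiber p" if "p \<in> A" for p
    using that A(1) subspace_0[OF subspace_W] by (auto simp: lattice_fiber_def X_eq intro!: bexI[of _ p])
  moreover have "p = q" if "p \<in> A" "q \<in> A" "p - q \<in> W" for p q
    using distinct_fibers that A(1) by blast
  moreover have "card (A \<inter> edge i j) \<le> 2" for i j
  proof (rule ccontr)
    assume "\<not> ?thesis"
    then have "3 \<le> card (A \<inter> edge i j)" by linarith
    then obtain T where T: "T \<subseteq> A \<inter> edge i j" "card T = 3"
      by (rule obtain_subset_with_card_n)
    then obtain x y z where xyz: "T = {x, y, z}" "x \<noteq> y" "x \<noteq> z" "y \<noteq> z"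
      by (auto simp: card_3_iff)
    have "\<not> affine_dependent {x, y, z}"
      using affine_independent_subset[OF A(2)] T xyz by blast
    then have "independent {y - x, z - x}"
      using affine_dependent_iff_dependent[of x "{y, z}"] xyz by simp
    then show False
      using lattice_points_on_edge_collinear[of x y z i j] T(1) xyz A(1) by blast
  qed
  ultimately show ?thesis by (auto simp: spread_def)
qed

lemma convex_hull_X_P: "convex hull X \<subseteq> P"
  by (intro hull_minimal convex_P) (auto simp: X_P)

text \<open>An edge through the midpoint contains \<open>p\<close> and \<open>q\<close>, hence no
  other point of \<open>A\<close>, and dropping \<open>q\<close> makes room for the midpoint. A
  point of \<open>A\<close> in the fiber of the midpoint would be on that edge too, which forces
  \<open>p - q\<close> into \<open>W\<close>.\<close>

lemma spread_replace_by_midpoint: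
  assumes A: "spread A" and pq: "p \<in> A" "q \<in> A" "p \<noteq> q"
    and fiber: "lattice_fiber ((1/2) *\<^sub>R (p + q))"
  shows "spread (insert ((1/2) *\<^sub>R (p + q)) (A - {q}))" "(1/2) *\<^sub>R (p + q) \<notin> A"
proof -
  let ?m = "(1/2) *\<^sub>R (p + q)"
  have finA: "finite A" using A card.infinite by (fastforce simp: spread_def)
  have AP: "A \<subseteq> P" using A convex_hull_X_P by (auto simp: spread_def)
  have cardE: "card (A \<inter> edge i j) \<le> 2" for i j using A by (simp add: spread_def)
  have E: "A \<inter> edge i j = {p, q}" if "?m \<in> edge i j" for i j
  proof -
    have "{p, q} \<subseteq> A \<inter> edge i j" using edge_midpoint[OF _ _ that] pq AP by auto
    moreover have "card {p, q} = 2" using pq by simp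
    ultimately show ?thesis using cardE[of i j] card_seteq[of "A \<inter> edge i j" "{p, q}"] finA by auto
  qed
  have mX: "?m \<in> convex hull X"
  proof -
    have "(1/2) *\<^sub>R p + (1/2) *\<^sub>R q \<in> convex hull X"
      using A pq by (intro convexD convex_convex_hull) (auto simp: spread_def)
    then show ?thesis by (simp add: scaleR_add_right)
  qed
  then have mP: "?m \<in> P" using convex_hull_X_P by blast
  have half: "(1/2) *\<^sub>R (p - q) \<notin> W"
  proof
    assume "(1/2) *\<^sub>R (p - q) \<in> W"
    then have "2 *\<^sub>R (1/2) *\<^sub>R (p - q) \<in> W" by (rule subspace_scale[OF subspace_W])
    then have "p - q \<in> W" by simp
    then show False using A pq by (auto simp: spread_def)
  qed
  have mid: "s - ?m \<notin> W" if s: "s \<in> A" for s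
  proof
    assume sm: "s - ?m \<in> W"
    obtain i j where ij: "?m \<in> edge i j" using in_edge[OF mP fiber] .
    have "s \<in> edge i j" using edge_fiber[OF ij _ sm] s AP by blast
    then have "s = p \<or> s = q" using E[OF ij] s by auto
    moreover have "p - ?m = (1/2) *\<^sub>R (p - q)" "q - ?m = - (1/2) *\<^sub>R (p - q)"
      by (simp_all add: vec_eq_iff field_simps)
    ultimately show False
      using half sm subspace_neg[OF subspace_W, of "q - ?m"] by auto
  qed
  then have mid': "?m - s \<notin> W" if s: "s \<in> A" for s
    using that subspace_neg[OF subspace_W, of "?m - s"] by auto
  show mA: "?m \<notin> A" using mid[of ?m] subspace_0[OF subspace_W] by auto
  let ?A = "insert ?m (A - {q})"
  have "card ?A = 5" using A pq finA mA by (simp add: spread_def card_Diff_singleton)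
  moreover have "card (?A \<inter> edge i j) \<le> 2" for i j
  proof (cases "?m \<in> edge i j")
    case True
    then have "?A \<inter> edge i j \<subseteq> {?m, p}" using E[OF True] by auto
    then show ?thesis using card_mono[of "{?m, p}" "?A \<inter> edge i j"] card_insert_le_m1[of 2 "{p}" ?m]
      by simp
  next
    case False
    then have "?A \<inter> edge i j \<subseteq> A \<inter> edge i j" by auto
    then show ?thesis using cardE[of i j] card_mono[of "A \<inter> edge i j"] finA by (meson finite_Int order_trans)
  qed
  moreover have "?A \<subseteq> convex hull X" using A mX by (auto simp: spread_def)
  moreover have "\<forall>s\<in>?A. lattice_fiber s" using A fiber by (auto simp: spread_def)
  moreover have "\<forall>s\<in>?A. \<forall>t\<in>?A. s - t \<in> W \<longrightarrow> s = t"
  proof (intro ballI impI)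
    fix s t assume st: "s \<in> ?A" "t \<in> ?A" "s - t \<in> W"
    show "s = t"
    proof (cases "s = ?m \<or> t = ?m")
      case True
      then show ?thesis using st mid mid' by blast
    next
      case False
      then have "s \<in> A" "t \<in> A" using st by auto
      then show ?thesis using A st(3) by (simp add: spread_def)
    qed
  qed
  ultimately show "spread ?A" unfolding spread_def by (intro conjI allI)
qed

text \<open>Infinite descent on the distances of the fibers from \<open>W\<close>.\<close>

lemma codim_2_contradiction: False
proof -
  obtain C where C: "finite C" "W = {x. \<forall>c\<in>C. c \<bullet> x = 0}"
    by (rule subspace_eq_orthogonal_to_finite[OF subspace_W])
  \<comment> \<open>A quadratic form that is positive definite modulo \<open>W\<close>.\<close>
  define g where "g x = (\<Sum>c\<in>C. (c \<bullet> x)\<^sup>2)" for x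
  have g_fiber: "g x = g y" if "x - y \<in> W" for x y
  proof -
    have "c \<bullet> x = c \<bullet> y" if "c \<in> C" for c
      using \<open>x - y \<in> W\<close> that by (auto simp: C(2) inner_diff_right)
    then show ?thesis by (simp add: g_def)
  qed
  have g_mid: "g ((1/2) *\<^sub>R (p + q)) < g q" if "g p \<le> g q" "p - q \<notin> W" for p q
  proof -
    have "4 * g ((1/2) *\<^sub>R (p + q)) = (\<Sum>c\<in>C. 2 * (c \<bullet> p)\<^sup>2 + 2 * (c \<bullet> q)\<^sup>2 - (c \<bullet> (p - q))\<^sup>2)"
      unfolding g_def sum_distrib_left
      by (intro sum.cong) (auto simp: inner_add_right inner_diff_right power2_eq_square algebra_simps)
    also have "\<dots> = 2 * g p + 2 * g q - g (p - q)"
      by (simp add: g_def sum.distrib sum_subtractf sum_distrib_left)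
    finally have *: "4 * g ((1/2) *\<^sub>R (p + q)) = 2 * g p + 2 * g q - g (p - q)" .
    have "g (p - q) \<noteq> 0"
      using that(2) C by (auto simp: g_def sum_nonneg_eq_0_iff)
    moreover have "g (p - q) \<ge> 0" by (simp add: g_def sum_nonneg)
    ultimately show ?thesis using * that(1) by linarith
  qed
  define G where "G = g ` {p \<in> convex hull X. lattice_fiber p}"
  have finG: "finite G"
    unfolding G_def using finite_values_on_lattice_fibers g_fiber by blast
  define h where "h p = card {v \<in> G. v < g p}" for p
  have h_less: "h p < h q" if "g p < g q" "g p \<in> G" for p q
    unfolding h_def using that finG by (intro psubset_card_mono) auto
  obtain A0 where "spread A0" using spread_exists by blast
  then obtain A where A: "spread A" and min: "\<And>A'. spread A' \<Longrightarrow> sum h A \<le> sum h A'"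
    using ex_has_least_nat[of spread A0 "sum h"] by blast
  have finA: "finite A" using A card.infinite by (fastforce simp: spread_def)
  obtain p q x where pq: "p \<in> A" "q \<in> A" "p \<noteq> q" "x \<in> int_lattice" "(1/2) *\<^sub>R (p + q) - x \<in> span B"
    using midpoint_in_lattice_fiber[OF card_d B_lattice B_indep card_B, of A] A
    by (auto simp: spread_def lattice_fiber_def W_def)
  \<comment> \<open>The point with the larger value of \<open>g\<close> is the one replaced.\<close>
  have descend: False if pq: "p \<in> A" "q \<in> A" "p \<noteq> q" and m: "lattice_fiber ((1/2) *\<^sub>R (p + q))"
    and le: "g p \<le> g q" for p q
  proof -
    let ?m = "(1/2) *\<^sub>R (p + q)"
    have A': "spread (insert ?m (A - {q}))" and mA: "?m \<notin> A"
      using spread_replace_by_midpoint[OF A pq m] by auto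
    have "p - q \<notin> W" using A pq by (auto simp: spread_def)
    then have "g ?m < g q" using g_mid le by blast
    moreover have "g ?m \<in> G" using A' m by (auto simp: G_def spread_def)
    ultimately have "h ?m < h q" by (rule h_less)
    moreover have "sum h (insert ?m (A - {q})) = h ?m + sum h (A - {q})"
      using finA mA by simp
    moreover have "sum h A = h q + sum h (A - {q})" using sum.remove[OF finA pq(2)] by simp
    ultimately show False using min[OF A'] by simp
  qed
  have m: "lattice_fiber ((1/2) *\<^sub>R (p + q))"
    using pq by (auto simp: lattice_fiber_def W_def)
  then have m': "lattice_fiber ((1/2) *\<^sub>R (q + p))" by (simp add: add.commute)
  show False
    using descend[OF pq(1,2,3) m] descend[OF pq(2,1) pq(3)[symmetric] m'] by linarith
qed

end

subsection \<open>Reduction to a description with a kernel\<close>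

text \<open>If the normals were a basis, then \<open>f t\<close>, which rounds \<open>t *\<^sub>R u\<close> to a lattice point, would satisfy
  all inequalities for all large \<open>t\<close>.\<close>

lemma finite_description_has_kernel:
  fixes a :: "'d::finite \<Rightarrow> real ^ 'd" and b :: "'d \<Rightarrow> real"
  assumes fin: "finite {x \<in> int_lattice. \<forall>i. a i \<bullet> x \<le> b i}"
  obtains l where "l \<noteq> 0" "\<And>i. a i \<bullet> l = 0"
proof (rule ccontr)
  assume no: "\<not> thesis"
  let ?M = "(\<chi> i. a i) :: real ^ 'd ^ 'd"
  have M: "(?M *v x) $ i = a i \<bullet> x" for x i
    by (simp add: matrix_vector_mult_def inner_vec_def)
  have "\<forall>x. ?M *v x = 0 \<longrightarrow> x = 0"
    using no that by (metis M zero_index)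
  then have "surj ((*v) ?M)"
    by (metis matrix_left_invertible_ker matrix_left_right_inverse matrix_right_invertible_surjective)
  \<comment> \<open>Along \<open>u\<close> all left-hand sides decrease at unit rate.\<close>
  then obtain u where "?M *v u = (\<chi> i. - 1)" by (metis surjD)
  then have u: "a i \<bullet> u = - 1" for i by (metis M vec_lambda_beta)
  define R where "R = (\<Sum>i\<in>UNIV. \<bar>b i\<bar> + (\<Sum>j\<in>UNIV. \<bar>a i $ j\<bar>))"
  define f where "f t = (\<chi> j. real_of_int \<lfloor>t * u $ j\<rfloor>)" for t
  have f_dist: "\<bar>a i \<bullet> f t + t\<bar> \<le> (\<Sum>j\<in>UNIV. \<bar>a i $ j\<bar>)" for i t
  proof -
    have "a i \<bullet> f t + t = a i \<bullet> (f t - t *\<^sub>R u)" by (simp add: u inner_diff_right)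
    also have "\<bar>\<dots>\<bar> \<le> (\<Sum>j\<in>UNIV. \<bar>a i $ j * (f t - t *\<^sub>R u) $ j\<bar>)"
      unfolding inner_vec_def inner_real_def by (rule sum_abs)
    also have "\<dots> \<le> (\<Sum>j\<in>UNIV. \<bar>a i $ j\<bar>)"
    proof (rule sum_mono)
      fix j
      have "\<bar>(f t - t *\<^sub>R u) $ j\<bar> \<le> 1" by (simp add: f_def) linarith
      then show "\<bar>a i $ j * (f t - t *\<^sub>R u) $ j\<bar> \<le> \<bar>a i $ j\<bar>"
        by (simp add: abs_mult mult_left_le)
    qed
    finally show ?thesis .
  qed
  have R: "\<bar>b i\<bar> + (\<Sum>j\<in>UNIV. \<bar>a i $ j\<bar>) \<le> R" for i
    unfolding R_def by (rule member_le_sum) (auto simp: sum_nonneg)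
  have "R \<ge> 0" unfolding R_def by (simp add: sum_nonneg)
  have in_set: "f t \<in> {x \<in> int_lattice. \<forall>i. a i \<bullet> x \<le> b i}" if "t \<ge> R" for t
  proof -
    have "a i \<bullet> f t \<le> b i" for i using f_dist[of i t] R[of i] that by linarith
    then show ?thesis by (simp add: int_lattice_def f_def)
  qed
  obtain i :: 'd where True by simp
  have close: "\<bar>s - t\<bar> \<le> 2 * (\<Sum>j\<in>UNIV. \<bar>a i $ j\<bar>)" if "f s = f t" for s t
    using f_dist[of i s] f_dist[of i t] unfolding that by linarith
  \<comment> \<open>Parameters with the same rounding differ by at most \<open>2 * R\<close>, so
    this spacing separates them; the offset \<open>R\<close> ensures that all inequalities
    hold.\<close>
  let ?T = "\<lambda>n. (2 * R + 1) * real n + R"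
  have "inj (\<lambda>n. f (?T n))"
  proof (rule injI)
    fix m n assume eq: "f (?T m) = f (?T n)"
    have "\<bar>?T m - ?T n\<bar> \<le> 2 * (\<Sum>j\<in>UNIV. \<bar>a i $ j\<bar>)"
      using eq by (rule close)
    also have "\<dots> < 2 * R + 1" using R[of i] by linarith
    finally have "(2 * R + 1) * \<bar>real m - real n\<bar> < (2 * R + 1) * 1"
      using \<open>R \<ge> 0\<close> by (simp add: abs_mult flip: right_diff_distrib)
    then have "\<bar>real m - real n\<bar> < 1" using \<open>R \<ge> 0\<close> by (simp add: mult_less_cancel_left)
    then show "m = n" by linarith
  qed
  then have "infinite (range (\<lambda>n. f (?T n)))" by (rule range_inj_infinite)
  moreover have "range (\<lambda>n. f (?T n)) \<subseteq> {x \<in> int_lattice. \<forall>i. a i \<bullet> x \<le> b i}"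
    using in_set \<open>R \<ge> 0\<close> by auto
  ultimately show False using fin finite_subset by blast
qed

text \<open>Indexing the inequalities by \<open>'d\<close> fixes their number to the dimension and
  makes the matrix of normals square.\<close>

lemma not_described_by_dim_inequalities:
  fixes a :: "'d::finite \<Rightarrow> real ^ 'd" and b :: "'d \<Rightarrow> real"
  assumes "CARD('d) \<le> 4" and X: "X = {x \<in> int_lattice. \<forall>i. a i \<bullet> x \<le> b i}"
    and fin: "finite X" and aff: "affine hull X = UNIV"
  shows False
proof -
  obtain l where l: "l \<noteq> 0" "\<And>i. a i \<bullet> l = 0"
    using finite_description_has_kernel fin X by blast
  define Q where "Q = (\<lambda>B. B \<subseteq> int_lattice \<and> l \<in> span B \<and> independent B)"
  have "Q Basis"
    by (simp add: Q_def Basis_subset_int_lattice independent_Basis)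
  then obtain B where B: "Q B" and min: "\<And>S. Q S \<Longrightarrow> card B \<le> card S"
    using ex_has_least_nat[of Q Basis card] by blast
  have minimal: "card B \<le> dim S" if S: "S \<subseteq> int_lattice" "l \<in> span S" for S
  proof -
    obtain T where T: "T \<subseteq> S" "independent T" "S \<subseteq> span T" "card T = dim S"
      using basis_exists by blast
    have "span S \<subseteq> span T" using T by (simp add: span_minimal)
    then have "Q T" using S T by (auto simp: Q_def)
    then show ?thesis using min T(4) by metis
  qed
  interpret flat_description a b X l B
    using B X fin aff l minimal by unfold_locales (auto simp: Q_def)
  have "card B < CARD('d)" by (rule card_B_less)
  moreover have "card B + 1 \<noteq> CARD('d)" using dim_ge_5_if_codim_1 assms(1) by auto
  \<comment> \<open>\<open>card B\<close> is at least 2 and at most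
    \<open>CARD('d) - 2\<close>.\<close>
  ultimately have d: "CARD('d) = 4" "card B = 2" using card_B_ge_2 assms(1) by linarith+
  have "\<not> W \<subseteq> span {l}"
  proof
    assume "W \<subseteq> span {l}"
    then have "dim W \<le> card {l}" by (intro dim_le_card) auto
    then show False using dim_W d by simp
  qed
  then obtain w where "w \<in> W" "w \<notin> span {l}" by blast
  then interpret flat_description_codim_2 a b X l B w
    using d by unfold_locales
  show False by (rule codim_2_contradiction)
qed

theorem corollary3p7:
  fixes X :: "(real ^ 'd) set"
  assumes "CARD('d) \<le> 4"
    and "X \<subseteq> int_lattice"
    and "finite X"
    and "lattice_convex X"
    and "affine hull X = UNIV"
  shows "rc X \<ge> enat (CARD('d) + 1)"
  unfolding rc_def
proof (rule INF_greatest, rule ccontr)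
  fix k assume "k \<in> {k. described_by X k}" and "\<not> enat (CARD('d) + 1) \<le> enat k"
  then have k: "k \<le> CARD('d)" by simp
  obtain A c U v and m :: nat where X: "X = {x \<in> int_lattice. (\<forall>i<k. A i \<bullet> x \<le> c i) \<and> (\<forall>j<m. U j \<bullet> x = v j)}"
    using \<open>k \<in> _\<close> unfolding described_by_def mem_Collect_eq by (elim exE)
  \<comment> \<open>The solution set of an equation is affine and contains \<open>X\<close>, so it
    is the whole space.\<close>
  have UV: "U j \<bullet> x = v j" if "j < m" for j x
  proof -
    have "affine hull X \<subseteq> {x. U j \<bullet> x = v j}"
      using X that by (intro hull_minimal) (auto simp: affine_hyperplane)
    then show ?thesis using assms(5) by auto
  qed
  obtain e :: "'d \<Rightarrow> nat" where e: "bij_betw e UNIV {0..<CARD('d)}"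
    using ex_bij_betw_finite_nat[of "UNIV :: 'd set"] by auto
  \<comment> \<open>Missing inequalities are filled in by the trivial one with zero normal and bound
    0.\<close>
  define a where "a i = (if e i < k then A (e i) else 0)" for i
  define b where "b i = (if e i < k then c (e i) else 0)" for i
  have "(\<forall>i<k. A i \<bullet> x \<le> c i) \<longleftrightarrow> (\<forall>i. a i \<bullet> x \<le> b i)" for x
  proof
    assume R: "\<forall>i. a i \<bullet> x \<le> b i"
    show "\<forall>n<k. A n \<bullet> x \<le> c n"
    proof (intro allI impI)
      fix n assume "n < k"
      then have "n \<in> e ` UNIV" using e k by (simp add: bij_betw_def)
      then obtain i where "n = e i" by blast
      then show "A n \<bullet> x \<le> c n" using R[rule_format, of i] \<open>n < k\<close> by (simp add: a_def b_def)
    qed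
  qed (simp add: a_def b_def)
  then have "X = {x \<in> int_lattice. \<forall>i. a i \<bullet> x \<le> b i}"
    using X UV by auto
  then show False
    using not_described_by_dim_inequalities assms by blast
qed

end
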